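(* Let $s=0$. Then $g_0(y)$ has the irreducible factorization over $\mathbb{F}_q$ $$g_0(y) = \frac{\tau^2}{2} \prod_{v} \Big(y^2-y+\frac{v}{4}\Big),$$ where the product is over all $v \in \mathbb{F}_q$ for which $\rho(v)=\rho(1-v)=-1$; i.e. this identity holds and each displayed quadratic factor is irreducible over $\mathbb{F}_q$.
   Context: $\mathbb{F}_q$ is a finite field with $q$ elements, $q$ a power of an odd prime; $n=(q+1)/2$; for $s\in\mathbb{F}_q$, $g_s(y) := y^n+(1-y)^n-s \in \mathbb{F}_q[y]$. $\rho$ is the quadratic character on $\mathbb{F}_q$ (with $\rho(0)=0$). $\tau = 1$ if $q\equiv 1 \pmod 4$ and $\tau = 2$ if $q \equiv 3 \pmod 4$. *)

theory Defs
  imports "HOL-Computational_Algebra.Computational_Algebra" "HOL-Library.Cardinality"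
begin

definition quadratic_character :: "'a::finite_field \<Rightarrow> int" where
  "quadratic_character x =
     (if x = 0 then 0 else if \<exists>y. x = y\<^sup>2 then 1 else - 1)"

text \<open>Here \<open>q\<close> is the number \<open>CARD('a)\<close> of elements of the field. The exponent below is
  \<open>n = (q + 1)/2\<close>; for odd \<open>q\<close> the division on natural numbers is exact.
  The polynomial \<open>[:0, 1:]\<close> is the variable \<open>y\<close>, and \<open>[:1, - 1:]\<close> is \<open>1 - y\<close>.\<close>

definition g_poly :: "'a::finite_field \<Rightarrow> 'a poly" where
  "g_poly s =
     (let n = (CARD('a) + 1) div 2 in [:0, 1:] ^ n + [:1, - 1:] ^ n - [:s:])"

text \<open>Only odd \<open>q\<close> is meaningful here, so the \<open>else\<close> branch is the case \<open>q mod 4 = 3\<close>.\<close>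

definition tau :: "nat \<Rightarrow> nat" where
  "tau q = (if q mod 4 = 1 then 1 else 2)"

end

theory Submission
  imports Defs "HOL-Number_Theory.Cong"
begin

text \<open>
  Write \<open>q = 2m + 1\<close> for the size of the field, so that \<open>g\<^sub>0 = y^(m+1) + (1 - y)^(m+1)\<close>, and let
  \<open>N\<close> be the set of \<open>v\<close> with \<open>v\<close> and \<open>1 - v\<close> both nonsquares.

  For \<open>v \<in> N\<close> the quadratic \<open>P\<^sub>v = y\<^sup>2 - y + v/4\<close> has the nonsquare discriminant \<open>1 - v\<close>, hence
  is irreducible. Its two roots are conjugate, so a root \<open>\<xi>\<close> in the quadratic
  extension satisfies \<open>\<xi>\<^sup>q = 1 - \<xi>\<close> and \<open>\<xi>^(q+1) = v/4\<close>. Consequently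
  \<open>(1 - \<xi>)^(m+1) = \<xi>^(q(m+1)) = \<xi>^(m+1) (\<xi>^(q+1))^m = \<xi>^(m+1) (v/4)^m = - \<xi>^(m+1)\<close>
  by Euler's criterion, and \<open>P\<^sub>v\<close> divides \<open>g\<^sub>0\<close>. Lemma \<open>quadratic_dvd_power_sum\<close> carries this
  out with congruences modulo \<open>P\<^sub>v\<close>, without leaving the polynomial ring.

  The \<open>P\<^sub>v\<close> are pairwise non-associated primes, so their product, of degree \<open>2 |N|\<close>, divides
  \<open>g\<^sub>0\<close>. It remains to see that \<open>g\<^sub>0\<close> has no larger degree, and to read off its leading
  coefficient (\<open>g_poly_0_top_coeff\<close>). If \<open>q \<equiv> 1 (mod 4)\<close>, the terms of degree \<open>m + 1\<close> cancel
  and the degree is \<open>m\<close>; otherwise it is \<open>m + 1\<close>. The cardinality of \<open>N\<close> is found without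
  Jacobi sums: the substitutions \<open>v \<mapsto> 1 - v\<close> and \<open>v \<mapsto> 1/v\<close> permute the classes of \<open>v\<close> with
  prescribed quadratic characters of \<open>v\<close> and \<open>1 - v\<close>, and this together with the number \<open>m\<close> of
  squares and of nonsquares determines \<open>|N|\<close> (\<open>card_v_and_1_minus_v_nonsquare\<close>).
\<close>

section \<open>Finite fields of odd order and Euler's criterion\<close>

text \<open>The translation \<open>x \<mapsto> x + 1\<close> permutes the field, so it does not change the sum of all
  elements.\<close>
lemma of_nat_card_eq_0: "of_nat (CARD('a)) = (0 :: 'a::finite_field)"
proof -
  have "(\<Sum>x::'a\<in>UNIV. x + 1) = (\<Sum>x\<in>UNIV. x)"
    by (rule sum.reindex_bij_witness[of _ "\<lambda>x. x - 1" "\<lambda>x. x + 1"]) auto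
  then show ?thesis by (simp add: sum.distrib)
qed

text \<open>If \<open>2 = 0\<close>, an odd cardinality would be \<open>1\<close> in the field, but it is \<open>0\<close>.\<close>
lemma two_neq_0:
  assumes "odd (CARD('a))"
  shows "(2 :: 'a::finite_field) \<noteq> 0"
proof
  assume "(2 :: 'a) = 0"
  obtain j where "CARD('a) = 2 * j + 1" using assms by (rule oddE)
  then have "(1 :: 'a) = 0"
    using of_nat_card_eq_0[where 'a = 'a] \<open>2 = 0\<close> by simp
  then show False by simp
qed

lemma four_neq_0:
  assumes "odd (CARD('a))"
  shows "(4 :: 'a::finite_field) \<noteq> 0"
proof -
  have "(4 :: 'a) = 2 * 2" by simp
  then show ?thesis using two_neq_0[OF assms] by (metis mult_eq_0_iff)
qed

lemma power_card_minus_1: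
  fixes x :: "'a::finite_field"
  assumes "CARD('a) = Suc e" "x \<noteq> 0"
  shows "x ^ e = 1"
  using finite_field_power_card_eq_same[of x] assms by simp

lemma card_square_roots_le: "card {y :: 'a::idom. y\<^sup>2 = z} \<le> 2"
proof -
  have "{y. y\<^sup>2 = z} = {y. poly [:- z, 0, 1:] y = 0}"
    by (auto simp: power2_eq_square)
  also have "card \<dots> \<le> degree [:- z, 0, 1:]"
    by (rule card_poly_roots_bound) simp
  finally show ?thesis by simp
qed

text \<open>Nonzero squares are roots of \<open>x\<^sup>m - 1\<close>, which has at most \<open>m\<close> roots; since squaring is
  at most two-to-one on the \<open>2m\<close> nonzero elements, there are at least \<open>m\<close> squares.\<close>
lemma power_roots_eq_squares:
  assumes "CARD('a::finite_field) = 2 * m + 1" "m > 0"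
  shows "{x :: 'a. x ^ m = 1} = (\<lambda>y. y\<^sup>2) ` (- {0})"
    and "card {x :: 'a. x ^ m = 1} = m"
proof -
  let ?R = "{x :: 'a. x ^ m = 1}" and ?S = "(\<lambda>y :: 'a. y\<^sup>2) ` (- {0})"
  have "?S \<subseteq> ?R"
    using power_card_minus_1[of "2 * m"] assms by (auto simp: power_mult[symmetric])
  then have SR: "card ?S \<le> card ?R" by (rule card_mono[rotated]) simp
  have deg: "degree (monom 1 m + [:- 1:] :: 'a poly) = m"
    using \<open>m > 0\<close> by (simp add: degree_add_eq_left degree_monom_eq)
  have "?R = {x. poly (monom 1 m + [:- 1:]) x = 0}" by (simp add: poly_monom)
  also have "card \<dots> \<le> degree (monom 1 m + [:- 1:] :: 'a poly)"
    by (rule card_poly_roots_bound) (use deg \<open>m > 0\<close> in force)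
  finally have R: "card ?R \<le> m" by (simp only: deg)
  have "2 * m = card (- {0 :: 'a})"
    using assms by (simp add: card_Diff_singleton Compl_eq_Diff_UNIV)
  also have "\<dots> \<le> card (\<Union>z\<in>?S. {y. y\<^sup>2 = z})"
    by (rule card_mono) auto
  also have "\<dots> \<le> (\<Sum>z\<in>?S. card {y. y\<^sup>2 = z})"
    by (rule card_UN_le) simp
  also have "\<dots> \<le> (\<Sum>z\<in>?S. 2)"
    by (rule sum_mono) (rule card_square_roots_le)
  finally have "m \<le> card ?S" by simp
  with SR R show "card ?R = m" by simp
  show "?R = ?S"
    by (rule sym, rule card_subset_eq) (use \<open>?S \<subseteq> ?R\<close> \<open>m \<le> card ?S\<close> SR R in auto)
qed

lemma half_card_pos:
  assumes "CARD('a::finite_field) = 2 * m + 1"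
  shows "m > 0"
proof (rule ccontr)
  assume "\<not> m > 0"
  then have "card {0 :: 'a, 1} \<le> 1" using assms
    by (metis card_mono finite subset_UNIV add_0 mult_0_right not_gr0)
  then show False by simp
qed

lemma half_power_cases:
  fixes x :: "'a::finite_field"
  assumes "CARD('a) = 2 * m + 1" "x \<noteq> 0"
  shows "x ^ m = 1 \<or> x ^ m = - 1"
proof -
  have "(x ^ m)\<^sup>2 = 1"
    using power_card_minus_1[of "2 * m" x] assms by (simp add: power_mult[symmetric] mult.commute)
  then show ?thesis by (simp add: power2_eq_1_iff)
qed

lemma quadratic_character_eq_minus_1_iff:
  fixes x :: "'a::finite_field"
  assumes q: "CARD('a) = 2 * m + 1"
  shows "quadratic_character x = - 1 \<longleftrightarrow> x ^ m = - 1"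
proof -
  have m: "m > 0" by (rule half_card_pos[OF q])
  have ne: "(1 :: 'a) \<noteq> - 1"
    using two_neq_0[where 'a = 'a] q
    by (metis add_eq_0_iff even_add even_mult_iff odd_one one_add_one)
  have sq: "x ^ m = 1 \<longleftrightarrow> x \<noteq> 0 \<and> (\<exists>y. x = y\<^sup>2)"
    using power_roots_eq_squares(1)[OF q m] by (auto simp: set_eq_iff image_iff)
  show ?thesis
    using half_power_cases[OF q, of x] sq ne m by (auto simp: quadratic_character_def power_0_left)
qed

lemma minus_1_neq_1:
  assumes "odd (CARD('a))"
  shows "(- 1 :: 'a::finite_field) \<noteq> 1"
  using two_neq_0[OF assms] by (metis add.right_inverse one_add_one)

lemma card_power_eq_minus_1:
  assumes q: "CARD('a::finite_field) = 2 * m + 1"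
  shows "card {x :: 'a. x ^ m = - 1} = m"
proof -
  have m: "m > 0" by (rule half_card_pos[OF q])
  have "{x :: 'a. x ^ m = 1} \<union> {x. x ^ m = - 1} = - {0}"
    using half_power_cases[OF q] m by (auto simp: power_0_left)
  moreover have "{x :: 'a. x ^ m = 1} \<inter> {x. x ^ m = - 1} = {}"
    using minus_1_neq_1[where 'a = 'a] q by auto
  ultimately have "card (- {0 :: 'a}) = card {x :: 'a. x ^ m = 1} + card {x :: 'a. x ^ m = - 1}"
    by (metis card_Un_disjoint finite)
  then show ?thesis
    using power_roots_eq_squares(2)[OF q m] q by (simp add: card_Diff_singleton Compl_eq_Diff_UNIV)
qed

section \<open>Pairs of nonsquares with sum 1\<close>

text \<open>With \<open>C a b\<close> the set of \<open>v\<close> such that \<open>v\<^sup>m = a\<close> and \<open>(1 - v)\<^sup>m = b\<close>, the map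
  \<open>v \<mapsto> 1 - v\<close> takes \<open>C a b\<close> to \<open>C b a\<close>, and \<open>v \<mapsto> 1/v\<close> takes it to
  \<open>C a ((- 1)\<^sup>m a b)\<close> because \<open>1 - 1/v = - (1 - v)/v\<close>. For even \<open>m\<close> the latter
  identifies \<open>C (- 1) (- 1)\<close> with \<open>C (- 1) 1\<close>, and these split the \<open>m\<close> nonsquares. For odd
  \<open>m\<close> it identifies \<open>C 1 1\<close> with \<open>C 1 (- 1)\<close>, and these split the \<open>m - 1\<close> squares other than
  \<open>0\<close> and \<open>1\<close>; as \<open>C (- 1) 1\<close> is equally large, \<open>m - (m - 1)/2\<close> elements remain for
  \<open>C (- 1) (- 1)\<close>.\<close>
lemma card_v_and_1_minus_v_nonsquare:
  assumes q: "CARD('a::finite_field) = 2 * m + 1"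
  shows "2 * card {v :: 'a. v ^ m = - 1 \<and> (1 - v) ^ m = - 1} = (if even m then m else m + 1)"
proof -
  define C :: "'a \<Rightarrow> 'a \<Rightarrow> 'a set" where
    "C a b = {v. v ^ m = a \<and> (1 - v) ^ m = b}" for a b
  have m: "m > 0" by (rule half_card_pos[OF q])
  have ne: "(- 1 :: 'a) \<noteq> 1" using minus_1_neq_1[where 'a = 'a] q by simp
  have reflect: "card (C a b) = card (C b a)" for a b
    by (rule bij_betw_same_card[of "\<lambda>v. 1 - v"], rule bij_betw_byWitness[of _ "\<lambda>v. 1 - v"])
      (auto simp: C_def)
  have invert_power: "(1 - inverse v) ^ m = (- 1) ^ m * (v ^ m * (1 - v) ^ m)"
    if "v ^ m = 1 \<or> v ^ m = - 1" for v :: 'a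
  proof -
    have "v \<noteq> 0" using that m by (auto simp: power_0_left)
    then have "1 - inverse v = (- 1) * (inverse v * (1 - v))"
      by (simp add: field_simps)
    then have "(1 - inverse v) ^ m = (- 1) ^ m * (inverse (v ^ m) * (1 - v) ^ m)"
      by (simp only: power_mult_distrib power_inverse)
    moreover have "inverse (v ^ m) = v ^ m" using that by auto
    ultimately show ?thesis by simp
  qed
  have invert: "card (C a b) = card (C a ((- 1) ^ m * (a * b)))" if a: "a = 1 \<or> a = - 1" for a b
  proof (rule bij_betw_same_card[of inverse], rule bij_betw_byWitness[of _ inverse])
    have aa: "inverse a = a" "a * a = 1" using a by auto
    have ss: "(- 1) ^ m * (a * ((- 1) ^ m * (a * b))) = b"
      using aa by (cases "even m") (auto simp: mult.assoc[symmetric])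
    show "inverse ` C a b \<subseteq> C a ((- 1) ^ m * (a * b))"
      using invert_power a aa by (auto simp: C_def power_inverse)
    show "inverse ` C a ((- 1) ^ m * (a * b)) \<subseteq> C a b"
      using invert_power a aa ss by (auto simp: C_def power_inverse)
  qed auto
  have cases: "(1 - v) ^ m = 1 \<or> (1 - v) ^ m = - 1" if "v \<noteq> 1" for v :: 'a
    using half_power_cases[OF q, of "1 - v"] that by simp
  have "C (- 1) 1 \<union> C (- 1) (- 1) = {v. v ^ m = - 1}"
    using cases ne unfolding C_def by (auto, metis power_one)
  moreover have "C (- 1) 1 \<inter> C (- 1) (- 1) = {}"
    using ne by (auto simp: C_def)
  ultimately have nonsq: "card (C (- 1) 1) + card (C (- 1) (- 1)) = m"
    by (metis card_Un_disjoint finite card_power_eq_minus_1[OF q])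
  have "insert 1 (C 1 1 \<union> C 1 (- 1)) = {v. v ^ m = 1}"
    using cases by (auto simp: C_def)
  moreover have "C 1 1 \<inter> C 1 (- 1) = {}" "1 \<notin> C 1 1 \<union> C 1 (- 1)"
    using ne m by (auto simp: C_def power_0_left)
  ultimately have sq: "Suc (card (C 1 1) + card (C 1 (- 1))) = m"
    by (metis card_Un_disjoint card_insert_disjoint finite power_roots_eq_squares(2)[OF q m])
  have "2 * card (C (- 1) (- 1)) = (if even m then m else m + 1)"
  proof (cases "even m")
    case True
    then show ?thesis using invert[of "- 1" 1] nonsq by simp
  next
    case False
    then show ?thesis using invert[of 1 1] reflect[of 1 "- 1"] sq nonsq by simp
  qed
  then show ?thesis by (simp only: C_def)
qed

section \<open>The quadratics divide the sum of powers\<close>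

text \<open>Both sides have degree \<open>q\<close>, are monic, and agree at all \<open>q\<close> points of the field,
  where the \<open>q\<close>-th power is the identity.\<close>
lemma linear_poly_power_card:
  "[:c, 1:] ^ CARD('a) = [:0, 1:] ^ CARD('a) + [:c :: 'a::finite_field:]"
proof (rule poly_eqI_degree_lead_coeff[where n = "CARD('a)" and A = UNIV])
  have pos: "CARD('a) > 0" by simp
  show "coeff ([:c, 1:] ^ CARD('a)) CARD('a) = coeff ([:0, 1:] ^ CARD('a) + [:c:]) CARD('a)"
    using pos by (auto simp: coeff_linear_power coeff_pCons split: nat.split)
  have deg: "degree ([:d, 1:] ^ CARD('a)) \<le> CARD('a)" for d :: 'a
    using degree_power_le[of "[:d, 1:]" "CARD('a)"] by simp
  then show "degree ([:c, 1:] ^ CARD('a)) \<le> CARD('a)" .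
  show "degree ([:0, 1:] ^ CARD('a) + [:c:]) \<le> CARD('a)"
    by (rule degree_add_le) (use deg in auto)
qed (simp_all add: finite_field_power_card_eq_same)

text \<open>Modulo \<open>P\<close>, the shifted variable \<open>W = X - 1/2\<close> has \<open>W\<^sup>2 \<equiv> (1 - v)/4\<close>, a nonsquare;
  hence \<open>W\<^sup>q = W (W\<^sup>2)\<^sup>m \<equiv> - W\<close>, which says that the Frobenius map exchanges \<open>X\<close> and
  \<open>Y = 1 - X\<close>. The product \<open>X Y\<close> is congruent to \<open>v/4\<close>.\<close>
lemma quadratic_dvd_power_sum:
  fixes v :: "'a::finite_field"
  assumes q: "CARD('a) = 2 * m + 1" and v: "v ^ m = - 1" "(1 - v) ^ m = - 1"
  shows "[:v / 4, - 1, 1:] dvd [:0, 1:] ^ (m + 1) + [:1, - 1:] ^ (m + 1)"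
proof -
  define P X Y W :: "'a poly" where
    "P = [:v / 4, - 1, 1:]" and "X = [:0, 1:]" and "Y = [:1, - 1:]" and "W = [:- (1 / 2), 1:]"
  have two: "(2 :: 'a) \<noteq> 0" and four: "(4 :: 'a) \<noteq> 0"
    using two_neq_0[where 'a = 'a] four_neq_0[where 'a = 'a] q by auto
  \<comment> \<open>As 4 is a square, dividing a nonsquare by it leaves a nonsquare.\<close>
  have "(4 :: 'a) ^ m = 2 ^ (2 * m)" by (simp add: power_mult)
  then have four_m: "(4 :: 'a) ^ m = 1"
    using power_card_minus_1[of "2 * m" "2 :: 'a"] q two by simp
  have half: "1 / 2 + 1 / 2 = (1 :: 'a)" "(1 / 2) * (1 / 2) = (1 / 4 :: 'a)"
    using two four by (simp_all add: field_simps)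
  have quarter: "1 / 4 = v / 4 + (1 - v) / 4"
    by (simp add: add_divide_distrib[symmetric])
  have "W ^ 2 - [:(1 - v) / 4:] = [:1 / 2 * (1 / 2) - (1 - v) / 4, - (1 / 2 + 1 / 2), 1:]"
    by (simp add: W_def power2_eq_square)
  also have "\<dots> = P"
    by (simp only: P_def half quarter) simp
  finally have "W ^ 2 - [:(1 - v) / 4:] = P" .
  then have W2: "[W ^ 2 = [:(1 - v) / 4:]] (mod P)"
    by (simp add: cong_iff_dvd_diff)
  have "[W * (W ^ 2) ^ m = W * [:(1 - v) / 4:] ^ m] (mod P)"
    by (intro cong_mult cong_pow W2) simp
  also have "W * [:(1 - v) / 4:] ^ m = - W"
    using v four_m by (simp add: poly_const_pow power_divide)
  also have "W * (W ^ 2) ^ m = X ^ CARD('a) - [:1 / 2:]"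
    using linear_poly_power_card[of "- (1 / 2) :: 'a"] q
    by (simp add: W_def X_def power_mult[symmetric])
  finally have "[X ^ CARD('a) - [:1 / 2:] + [:1 / 2:] = - W + [:1 / 2:]] (mod P)"
    by (intro cong_add) simp_all
  moreover have "- W + [:1 / 2:] = Y"
    using half by (simp add: W_def Y_def)
  ultimately have frob: "[X ^ CARD('a) = Y] (mod P)" by simp
  have "X * Y - [:v / 4:] = - P"
    by (simp add: X_def Y_def P_def)
  then have XY: "[X * Y = [:v / 4:]] (mod P)"
    by (simp add: cong_iff_dvd_diff)
  have "[X * X ^ CARD('a) = X * Y] (mod P)"
    by (intro cong_mult frob) simp
  then have nrm: "[X * X ^ CARD('a) = [:v / 4:]] (mod P)"
    using XY by (rule cong_trans)
  \<comment> \<open>The exponent is split as \<open>q (m + 1) = (m + 1) + (q + 1) m\<close>.\<close>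
  have "[Y ^ (m + 1) = (X ^ CARD('a)) ^ (m + 1)] (mod P)"
    by (intro cong_pow cong_sym[OF frob])
  also have "(X ^ CARD('a)) ^ (m + 1) = X ^ (m + 1) * (X * X ^ CARD('a)) ^ m"
    unfolding power_Suc[symmetric] power_mult[symmetric] power_add[symmetric] q
    by (simp add: algebra_simps)
  also have "[\<dots> = X ^ (m + 1) * [:v / 4:] ^ m] (mod P)"
    by (intro cong_mult cong_pow nrm) simp
  also have "X ^ (m + 1) * [:v / 4:] ^ m = - (X ^ (m + 1))"
    using v four_m by (simp add: poly_const_pow power_divide)
  finally have "P dvd Y ^ (m + 1) - (- (X ^ (m + 1)))"
    by (simp only: cong_iff_dvd_diff)
  then show ?thesis
    unfolding P_def X_def Y_def by (simp only: diff_minus_eq_add add.commute)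
qed

section \<open>Irreducibility and the product of the quadratics\<close>

lemma irreducible_degree_2_no_root:
  fixes p :: "'a::field poly"
  assumes "degree p = 2" and no_root: "\<And>x. poly p x \<noteq> 0"
  shows "irreducible p"
proof (rule irreducibleI)
  show "p \<noteq> 0" using assms(1) by auto
  show "\<not> p dvd 1" using assms(1) by (simp add: is_unit_iff_degree[OF \<open>p \<noteq> 0\<close>])
  fix a b assume ab: "p = a * b"
  then have nz: "a \<noteq> 0" "b \<noteq> 0" using \<open>p \<noteq> 0\<close> by auto
  have linear: False if "c dvd p" "degree c = 1" for c
  proof -
    obtain d e where c: "c = [:d, e:]" "e \<noteq> 0" using \<open>degree c = 1\<close>
      by (metis degree_pCons_eq_if degree_eq_zeroE One_nat_def pCons_cases zero_neq_one nat.inject pCons_eq_0_iff)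
    then have "poly c (- d / e) = 0" by simp
    then have "poly p (- d / e) = 0" using \<open>c dvd p\<close> by (metis poly_eq_0_iff_dvd dvd_trans)
    then show False using no_root by blast
  qed
  have "degree a + degree b = 2" using assms(1) nz by (simp add: ab degree_mult_eq)
  moreover have "degree a \<noteq> 1" using linear[of a] ab by auto
  moreover have "degree b \<noteq> 1" using linear[of b] ab by auto
  ultimately have "degree a = 0 \<or> degree b = 0" by linarith
  then show "a dvd 1 \<or> b dvd 1" using nz by (simp add: is_unit_iff_degree)
qed

text \<open>At a root \<open>x\<close> the discriminant \<open>1 - v\<close> would be the square \<open>(2x - 1)\<^sup>2\<close>.\<close>
lemma irreducible_quadratic:
  fixes v :: "'a::finite_field"
  assumes "odd (CARD('a))" and "quadratic_character (1 - v) = - 1"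
  shows "irreducible [:v / 4, - 1, 1:]"
proof (rule irreducible_degree_2_no_root)
  fix x :: 'a
  have four: "(4 :: 'a) \<noteq> 0" by (rule four_neq_0[OF assms(1)])
  show "poly [:v / 4, - 1, 1:] x \<noteq> 0"
  proof
    assume "poly [:v / 4, - 1, 1:] x = 0"
    then have "4 * (v / 4 + x * (x - 1)) = 0" by simp
    then have "v + 4 * (x * (x - 1)) = 0" using four by (simp add: distrib_left)
    then have "1 - v = (2 * x - 1)\<^sup>2"
      by (simp add: power2_eq_square algebra_simps)
    then show False using assms(2) by (auto simp: quadratic_character_def split: if_splits)
  qed
qed simp

text \<open>If \<open>g = prod f A * h\<close> and a further prime \<open>f a\<close> divides \<open>g\<close>, it must divide \<open>h\<close>,
  since otherwise it would divide one of the other primes.\<close>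
lemma prod_prime_elem_dvd:
  fixes f :: "'b \<Rightarrow> 'a::idom"
  assumes "finite A" "\<And>i. i \<in> A \<Longrightarrow> prime_elem (f i)" "\<And>i. i \<in> A \<Longrightarrow> f i dvd g"
    and "\<And>i j. i \<in> A \<Longrightarrow> j \<in> A \<Longrightarrow> i \<noteq> j \<Longrightarrow> \<not> f i dvd f j"
  shows "prod f A dvd g"
  using assms
proof (induction A)
  case (insert a A)
  then obtain h where h: "g = prod f A * h" by (metis dvdE insertCI)
  have pa: "prime_elem (f a)" using insert.prems by simp
  have not_dvd: "\<not> f a dvd f b" if "b \<in> A" for b
    using that insert.prems(3)[of a b] insert.hyps(2) by auto
  have not_dvd_prod: "\<not> f a dvd prod f B" if "B \<subseteq> A" for B
    using finite_subset[OF that insert.hyps(1)] that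
  proof (induction B)
    case empty
    then show ?case using pa by (auto simp: prime_elem_def)
  next
    case (insert b B)
    moreover have "\<not> f a dvd f b" using not_dvd insert.prems \<open>a \<notin> A\<close> by auto
    ultimately show ?case using pa by (simp add: prime_elem_dvd_mult_iff)
  qed
  have "f a dvd prod f A * h" using insert.prems(2)[of a] h by simp
  then have "f a dvd h"
    using pa not_dvd_prod[OF order.refl] by (simp add: prime_elem_dvd_mult_iff)
  then show ?case using insert.hyps by (simp add: h mult.commute mult_dvd_mono)
qed simp

section \<open>The leading term and the factorization\<close>

text \<open>The coefficient at \<open>m + 1\<close> is \<open>1 + (- 1)^(m+1)\<close>. If \<open>m\<close> is odd it is \<open>2\<close>. If \<open>m\<close> is even it
  vanishes, and the coefficient at \<open>m\<close> is \<open>m + 1\<close>, which equals \<open>1/2\<close> in the field because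
  \<open>2 (m + 1) = q + 1\<close>.\<close>
lemma g_poly_0_top_coeff:
  assumes q: "CARD('a::finite_field) = 2 * m + 1"
  defines "d \<equiv> if even m then m else m + 1"
  shows "degree (g_poly (0 :: 'a)) \<le> d"
    and "coeff (g_poly (0 :: 'a)) d = of_nat (tau (CARD('a))) ^ 2 / 2"
    and "coeff (g_poly (0 :: 'a)) d \<noteq> 0"
proof -
  have two: "(2 :: 'a) \<noteq> 0" using two_neq_0[where 'a = 'a] q by simp
  have g: "g_poly (0 :: 'a) = [:0, 1:] ^ (m + 1) + [:1, - 1:] ^ (m + 1)"
    using q by (simp add: g_poly_def)
  have coeff: "coeff (g_poly (0 :: 'a)) i
      = of_nat ((m + 1) choose i) * (0 ^ (m + 1 - i) + (- 1) ^ i)" if "i \<le> m + 1" for i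
    using that by (simp only: g coeff_add coeff_linear_poly_power) (simp add: algebra_simps)
  have le: "degree (g_poly (0 :: 'a)) \<le> m + 1"
    unfolding g using degree_power_le[of "[:0, 1::'a:]" "m + 1"] degree_power_le[of "[:1, - 1::'a:]" "m + 1"]
    by (intro degree_add_le) simp_all
  show "degree (g_poly (0 :: 'a)) \<le> d"
  proof (cases "even m")
    case True
    then have "coeff (g_poly (0 :: 'a)) (m + 1) = 0" using coeff[of "m + 1"] by simp
    then have "degree (g_poly (0 :: 'a)) \<noteq> m + 1"
      by (metis Suc_eq_plus1 degree_0 leading_coeff_0_iff nat.distinct(1))
    then show ?thesis using le True by (simp add: d_def)
  qed (use le in \<open>simp add: d_def\<close>)
  have mod4: "CARD('a) mod 4 = 1 \<longleftrightarrow> even m" using q by presburger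
  have "2 * (of_nat m + 1) = (1 :: 'a)"
    using of_nat_card_eq_0[where 'a = 'a] q by (simp add: algebra_simps)
  then have half: "of_nat m + 1 = (1 / 2 :: 'a)" using two by (simp add: field_simps)
  show c: "coeff (g_poly (0 :: 'a)) d = of_nat (tau (CARD('a))) ^ 2 / 2"
    using coeff[of d] half two mod4
    by (cases "even m") (auto simp: d_def tau_def power2_eq_square add.commute)
  show "coeff (g_poly (0 :: 'a)) d \<noteq> 0"
    using two by (simp add: c tau_def power2_eq_square)
qed

theorem theorem2p4:
  fixes p k :: nat
  assumes "prime p" and "odd p" and "CARD('a::finite_field) = p ^ k"
  shows "g_poly (0 :: 'a) =
           smult (of_nat (tau (CARD('a))) ^ 2 / 2)
             (\<Prod>v | quadratic_character v = - 1 \<and> quadratic_character (1 - v) = - 1.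
                [:v / 4, - 1, 1:])
         \<and> (\<forall>v :: 'a. quadratic_character v = - 1 \<and> quadratic_character (1 - v) = - 1 \<longrightarrow>
                irreducible [:v / 4, - 1, 1:])"
proof
  have odd: "odd (CARD('a))" using assms by simp
  then obtain m where q: "CARD('a) = 2 * m + 1" by (rule oddE)
  let ?F = "\<lambda>v :: 'a. [:v / 4, - 1, 1:]" and ?g = "g_poly (0 :: 'a)"
  define N where "N = {v :: 'a. quadratic_character v = - 1 \<and> quadratic_character (1 - v) = - 1}"
  define d where "d = (if even m then m else m + 1)"
  have four: "(4 :: 'a) \<noteq> 0" by (rule four_neq_0[OF odd])
  show irr: "\<forall>v. quadratic_character v = - 1 \<and> quadratic_character (1 - v) = - 1 \<longrightarrow> irreducible (?F v)"
    using irreducible_quadratic[OF odd] by blast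
  have N: "N = {v. v ^ m = - 1 \<and> (1 - v) ^ m = - 1}"
    by (simp add: N_def quadratic_character_eq_minus_1_iff[OF q])
  have "prod ?F N dvd ?g"
  proof (rule prod_prime_elem_dvd)
    fix v assume v: "v \<in> N"
    show "prime_elem (?F v)" using irr v by (auto simp: N_def intro: field_poly_irreducible_imp_prime)
    show "?F v dvd ?g"
      using quadratic_dvd_power_sum[OF q, of v] v q by (simp add: N g_poly_def)
    fix w assume "w \<in> N" "v \<noteq> w"
    \<comment> \<open>Distinct quadratics differ by a nonzero constant.\<close>
    show "\<not> ?F v dvd ?F w"
    proof
      assume "?F v dvd ?F w"
      then have "?F v dvd ?F w - ?F v" by (rule dvd_diff) simp
      then have "degree (?F v) \<le> degree (?F w - ?F v)"
        by (rule dvd_imp_degree) (use four \<open>v \<noteq> w\<close> in auto)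
      then show False by simp
    qed
  qed simp
  then obtain h where h: "?g = prod ?F N * h" by (rule dvdE)
  have top: "degree ?g \<le> d" "coeff ?g d = of_nat (tau (CARD('a))) ^ 2 / 2" "coeff ?g d \<noteq> 0"
    unfolding d_def by (fact g_poly_0_top_coeff[OF q])+
  have monic: "lead_coeff (prod ?F N) = 1" by (simp add: lead_coeff_prod)
  have "degree (prod ?F N) = 2 * card N" by (subst degree_prod_sum_eq) simp_all
  also have "\<dots> = d" unfolding N d_def by (rule card_v_and_1_minus_v_nonsquare[OF q])
  finally have deg: "degree (prod ?F N) = d" .
  have nz: "prod ?F N \<noteq> 0" "h \<noteq> 0" using top(3) h by auto
  then have "degree h = 0" using top(1) deg by (simp add: h degree_mult_eq)
  then obtain c where c: "h = [:c:]" by (rule degree_eq_zeroE)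
  have "c = coeff ?g d" using monic deg by (simp add: h c)
  moreover have "?g = smult c (prod ?F N)" by (simp add: h c)
  ultimately have "?g = smult (of_nat (tau (CARD('a))) ^ 2 / 2) (prod ?F N)"
    using top(2) by metis
  then show "?g = smult (of_nat (tau (CARD('a))) ^ 2 / 2)
      (\<Prod>v | quadratic_character v = - 1 \<and> quadratic_character (1 - v) = - 1. ?F v)"
    by (simp only: N_def)
qed

end
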